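(* Let $E$ be a quandle, and let $N\le\mathrm{Dis}(E)$ be a subgroup which is normal in $\mathrm{LMlt}(E)$ and central in $\mathrm{Dis}(E)$, such that $E/\mathcal{O}_N$ is connected. Then $E$ is isomorphic to a central extension $(E/\mathcal{O}_N)\times_{\phi,\psi,\theta}A$ for some abelian group $A$ and some $\phi,\psi,\theta$.
   Context: A left quasigroup is a nonempty set $Q$ with two binary operations $*,\backslash$ satisfying $x\backslash(x*y)=y=x*(x\backslash y)$; write $L_a(b)=a*b$, a permutation of $Q$. A quandle is a left quasigroup satisfying $x*(y*z)=(x*y)*(x*z)$ and $x*x=x$. $\mathrm{LMlt}(Q)=\langle L_a:a\in Q\rangle$, $\mathrm{Dis}(Q)=\langle L_aL_b^{-1}:a,b\in Q\rangle$, both acting naturally on $Q$. $Q$ is connected if $\mathrm{LMlt}(Q)$ is transitive on $Q$. For $N\trianglelefteq\mathrm{LMlt}(Q)$, $\mathcal{O}_N$ is the relation of lying in the same $N$-orbit; for racks (in particular quandles) it is a congruence (an equivalence compatible with $*$ and $\backslash$). Given a left quasigroup $Q$, an abelian group $A$ and mappings $\phi:Q\times Q\to\mathrm{End}(A)$, $\psi:Q\times Q\to\mathrm{Aut}(A)$, $\theta:Q\times Q\to A$, the abelian extension $Q\times_{\phi,\psi,\theta}A$ is the left quasigroup on $Q\times A$ with $(a,s)*(b,t)=(a*b,\ \phi_{a,b}(s)+\psi_{a,b}(t)+\theta_{a,b})$. It is called a central extension if $\phi$ and $\psi$ are constant mappings. *)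

theory Defs
  imports "HOL-Algebra.Group_Action" "HOL-Algebra.Generated_Groups"
begin

section \<open>Left quasigroups and quandles\<close>

record 'a left_quasigroup = "'a partial_object" +
  lmult :: "['a, 'a] \<Rightarrow> 'a" (infixl "\<star>\<index>" 70)
  ldiv :: "['a, 'a] \<Rightarrow> 'a" (infixl "\<setminus>\<index>" 70)

locale left_quasigroup =
  fixes Q (structure)
  assumes nonempty: "carrier Q \<noteq> {}"
    and lmult_closed: "\<lbrakk>x \<in> carrier Q; y \<in> carrier Q\<rbrakk> \<Longrightarrow> x \<star> y \<in> carrier Q"
    and ldiv_closed: "\<lbrakk>x \<in> carrier Q; y \<in> carrier Q\<rbrakk> \<Longrightarrow> x \<setminus> y \<in> carrier Q"
    and ldiv_lmult: "\<lbrakk>x \<in> carrier Q; y \<in> carrier Q\<rbrakk> \<Longrightarrow> x \<setminus> (x \<star> y) = y"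
    and lmult_ldiv: "\<lbrakk>x \<in> carrier Q; y \<in> carrier Q\<rbrakk> \<Longrightarrow> x \<star> (x \<setminus> y) = y"

locale quandle = left_quasigroup +
  assumes left_distrib:
      "\<lbrakk>x \<in> carrier Q; y \<in> carrier Q; z \<in> carrier Q\<rbrakk>
        \<Longrightarrow> x \<star> (y \<star> z) = (x \<star> y) \<star> (x \<star> z)"
    and idem: "x \<in> carrier Q \<Longrightarrow> x \<star> x = x"

definition lq_iso ::
    "('a, 'c) left_quasigroup_scheme \<Rightarrow> ('b, 'd) left_quasigroup_scheme \<Rightarrow> ('a \<Rightarrow> 'b) set"
  where "lq_iso Q R = {h. bij_betw h (carrier Q) (carrier R) \<and>
     (\<forall>x\<in>carrier Q. \<forall>y\<in>carrier Q. h (x \<star>\<^bsub>Q\<^esub> y) = h x \<star>\<^bsub>R\<^esub> h y \<and>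
                                  h (x \<setminus>\<^bsub>Q\<^esub> y) = h x \<setminus>\<^bsub>R\<^esub> h y)}"

definition lq_isomorphic ::
    "('a, 'c) left_quasigroup_scheme \<Rightarrow> ('b, 'd) left_quasigroup_scheme \<Rightarrow> bool"
  where "lq_isomorphic Q R \<longleftrightarrow> lq_iso Q R \<noteq> {}"


section \<open>Left multiplication group and displacement group\<close>

text \<open>Permutations of a carrier are elements of \<^const>\<open>BijGroup\<close>, hence extensional; this is
  why the translations below are restricted to the carrier.\<close>

definition ltrans :: "('a, 'c) left_quasigroup_scheme \<Rightarrow> 'a \<Rightarrow> 'a \<Rightarrow> 'a"
  where "ltrans Q a = (\<lambda>b\<in>carrier Q. a \<star>\<^bsub>Q\<^esub> b)"

definition LMlt :: "('a, 'c) left_quasigroup_scheme \<Rightarrow> ('a \<Rightarrow> 'a) monoid"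
  where "LMlt Q = (BijGroup (carrier Q))
     \<lparr>carrier := generate (BijGroup (carrier Q)) {ltrans Q a | a. a \<in> carrier Q}\<rparr>"

definition Dis :: "('a, 'c) left_quasigroup_scheme \<Rightarrow> ('a \<Rightarrow> 'a) monoid"
  where "Dis Q = (BijGroup (carrier Q))
     \<lparr>carrier := generate (BijGroup (carrier Q))
        {ltrans Q a \<otimes>\<^bsub>BijGroup (carrier Q)\<^esub> inv\<^bsub>BijGroup (carrier Q)\<^esub> ltrans Q b | a b.
           a \<in> carrier Q \<and> b \<in> carrier Q}\<rparr>"

definition lq_connected :: "('a, 'c) left_quasigroup_scheme \<Rightarrow> bool"
  where "lq_connected Q \<longleftrightarrow> transitive_action (LMlt Q) (carrier Q) (\<lambda>g. g)"

text \<open>\<open>(\<lambda>g. g)\<close> is an action in the library's sense, so that \<^const>\<open>lq_connected\<close> is just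
  transitivity.\<close>

lemma (in left_quasigroup) ltrans_Bij:
  assumes "a \<in> carrier Q"
  shows "ltrans Q a \<in> carrier (BijGroup (carrier Q))"
proof -
  have "bij_betw (ltrans Q a) (carrier Q) (carrier Q)"
    by (rule bij_betwI[where g = "\<lambda>b. a \<setminus> b"])
      (auto simp: ltrans_def assms lmult_closed ldiv_closed ldiv_lmult lmult_ldiv)
  then show ?thesis
    by (simp add: BijGroup_def Bij_def ltrans_def)
qed

lemma (in left_quasigroup) subgroup_LMlt:
  "subgroup (carrier (LMlt Q)) (BijGroup (carrier Q))"
  unfolding LMlt_def using ltrans_Bij
  by (auto intro!: group.generate_is_subgroup[OF group_BijGroup])

lemma (in left_quasigroup) group_action_LMlt:
  "group_action (LMlt Q) (carrier Q) (\<lambda>g. g)"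
proof -
  have "LMlt Q = (BijGroup (carrier Q))\<lparr>carrier := carrier (LMlt Q)\<rparr>"
    by (simp add: LMlt_def)
  then have "group (LMlt Q)" "(\<lambda>g. g) \<in> hom (LMlt Q) (BijGroup (carrier Q))"
    using subgroup.subgroup_is_group[OF subgroup_LMlt group_BijGroup]
      subgroup.subset[OF subgroup_LMlt]
    by (auto simp: hom_def LMlt_def)
  then show ?thesis
    by (simp add: group_action_def group_hom_def group_hom_axioms_def group_BijGroup)
qed

lemma (in left_quasigroup) lq_connected_iff:
  "lq_connected Q \<longleftrightarrow>
     (\<forall>x\<in>carrier Q. \<forall>y\<in>carrier Q. \<exists>g\<in>carrier (LMlt Q). g x = y)"
  using group_action_LMlt
  by (auto simp: lq_connected_def transitive_action_def transitive_action_axioms_def)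


section \<open>Orbit relations and quotients\<close>

definition orbit_rel :: "('a, 'c) left_quasigroup_scheme \<Rightarrow> ('a \<Rightarrow> 'a) set \<Rightarrow> ('a \<times> 'a) set"
  where "orbit_rel Q N = {(x, y) \<in> carrier Q \<times> carrier Q.
     y \<in> orbit ((LMlt Q)\<lparr>carrier := N\<rparr>) (\<lambda>g. g) x}"

text \<open>The operations on classes; the unions are over representatives and all their members agree
  when \<open>r\<close> is a congruence (see \<open>orbit_rel_congruence\<close> and \<open>lq_quotient_lmult\<close> below).\<close>

definition lq_quotient ::
    "('a, 'c) left_quasigroup_scheme \<Rightarrow> ('a \<times> 'a) set \<Rightarrow> 'a set left_quasigroup"
  where "lq_quotient Q r =
    \<lparr>carrier = carrier Q // r,
     lmult = (\<lambda>X Y. \<Union>x\<in>X. \<Union>y\<in>Y. r `` {x \<star>\<^bsub>Q\<^esub> y}),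
     ldiv = (\<lambda>X Y. \<Union>x\<in>X. \<Union>y\<in>Y. r `` {x \<setminus>\<^bsub>Q\<^esub> y})\<rparr>"

definition lq_congruence :: "('a, 'c) left_quasigroup_scheme \<Rightarrow> ('a \<times> 'a) set \<Rightarrow> bool"
  where "lq_congruence Q r \<longleftrightarrow> equiv (carrier Q) r \<and>
     (\<forall>(x, x') \<in> r. \<forall>(y, y') \<in> r.
        (x \<star>\<^bsub>Q\<^esub> y, x' \<star>\<^bsub>Q\<^esub> y') \<in> r \<and> (x \<setminus>\<^bsub>Q\<^esub> y, x' \<setminus>\<^bsub>Q\<^esub> y') \<in> r)"

lemma lq_quotient_lmult:
  assumes "lq_congruence Q r" "x \<in> carrier Q" "y \<in> carrier Q"
  shows "(r `` {x}) \<star>\<^bsub>lq_quotient Q r\<^esub> (r `` {y}) = r `` {x \<star>\<^bsub>Q\<^esub> y}"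
proof -
  have e: "equiv (carrier Q) r" using assms(1) by (simp add: lq_congruence_def)
  have "congruent2 r r (\<lambda>x y. r `` {x \<star>\<^bsub>Q\<^esub> y})"
  proof (rule congruent2I')
    fix y1 z1 y2 z2 assume "(y1, z1) \<in> r" "(y2, z2) \<in> r"
    then have "(y1 \<star>\<^bsub>Q\<^esub> y2, z1 \<star>\<^bsub>Q\<^esub> z2) \<in> r"
      using assms(1) unfolding lq_congruence_def by fast
    then show "r `` {y1 \<star>\<^bsub>Q\<^esub> y2} = r `` {z1 \<star>\<^bsub>Q\<^esub> z2}"
      using e by (rule equiv_class_eq[rotated])
  qed
  from UN_equiv_class2[OF e e this assms(2,3)] show ?thesis
    by (simp add: lq_quotient_def)
qed

lemma lq_quotient_ldiv:
  assumes "lq_congruence Q r" "x \<in> carrier Q" "y \<in> carrier Q"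
  shows "(r `` {x}) \<setminus>\<^bsub>lq_quotient Q r\<^esub> (r `` {y}) = r `` {x \<setminus>\<^bsub>Q\<^esub> y}"
proof -
  have e: "equiv (carrier Q) r" using assms(1) by (simp add: lq_congruence_def)
  have "congruent2 r r (\<lambda>x y. r `` {x \<setminus>\<^bsub>Q\<^esub> y})"
  proof (rule congruent2I')
    fix y1 z1 y2 z2 assume "(y1, z1) \<in> r" "(y2, z2) \<in> r"
    then have "(y1 \<setminus>\<^bsub>Q\<^esub> y2, z1 \<setminus>\<^bsub>Q\<^esub> z2) \<in> r"
      using assms(1) unfolding lq_congruence_def by fast
    then show "r `` {y1 \<setminus>\<^bsub>Q\<^esub> y2} = r `` {z1 \<setminus>\<^bsub>Q\<^esub> z2}"
      using e by (rule equiv_class_eq[rotated])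
  qed
  from UN_equiv_class2[OF e e this assms(2,3)] show ?thesis
    by (simp add: lq_quotient_def)
qed

lemma (in quandle) LMlt_lmult:
  assumes "g \<in> carrier (LMlt Q)" "x \<in> carrier Q" "y \<in> carrier Q"
  shows "g (x \<star> y) = g x \<star> g y"
proof -
  let ?B = "BijGroup (carrier Q)"
  let ?S = "{ltrans Q a | a. a \<in> carrier Q}"
  interpret B: group ?B by (rule group_BijGroup)
  have S: "?S \<subseteq> carrier ?B" using ltrans_Bij by auto
  have Bc: "f z \<in> carrier Q" if "f \<in> carrier ?B" "z \<in> carrier Q" for f z
    using that by (auto simp: BijGroup_def Bij_def bij_betw_def)
  have Bm: "(f \<otimes>\<^bsub>?B\<^esub> h) z = f (h z)"
    if "f \<in> carrier ?B" "h \<in> carrier ?B" "z \<in> carrier Q" for f h z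
    using that by (simp add: BijGroup_def compose_def)
  have B1: "\<one>\<^bsub>?B\<^esub> z = z" if "z \<in> carrier Q" for z
    using that by (simp add: BijGroup_def)
  have L: "f (x \<star> y) = f x \<star> f y" if f: "f \<in> ?S" and xy: "x \<in> carrier Q" "y \<in> carrier Q" for f x y
  proof -
    obtain a where a: "f = ltrans Q a" "a \<in> carrier Q" using f by blast
    show ?thesis
      unfolding a(1) ltrans_def
      using left_distrib[OF a(2) xy] xy lmult_closed[OF xy] by simp
  qed
  have "g \<in> generate ?B ?S" using assms(1) by (simp add: LMlt_def)
  then show ?thesis using assms(2,3)
  proof (induction arbitrary: x y)
    case one
    then show ?case by (simp add: B1 lmult_closed)
  next
    case (incl h)
    then show ?case by (rule L)
  next
    case (inv h)
    have h: "h \<in> carrier ?B" using inv S by blast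
    let ?i = "inv\<^bsub>?B\<^esub> h"
    have i: "?i \<in> carrier ?B" using h by simp
    have hi: "h (?i z) = z" "?i (h z) = z" if "z \<in> carrier Q" for z
      using Bm[OF h i that] Bm[OF i h that] B1[OF that] h by auto
    have "x \<star> y = h (?i x \<star> ?i y)"
      using L[OF inv(1) Bc[OF i inv(2)] Bc[OF i inv(3)]] hi inv by simp
    then show ?case
      using hi(2)[OF lmult_closed[OF Bc[OF i inv(2)] Bc[OF i inv(3)]]] by simp
  next
    case (eng f h)
    have "f \<in> carrier ?B" "h \<in> carrier ?B"
      using eng B.generate_in_carrier[OF S] by auto
    then show ?case using eng by (simp add: Bm Bc lmult_closed)
  qed
qed

lemma (in quandle) orbit_rel_congruence:
  assumes "N \<lhd> LMlt Q"
  shows "lq_congruence Q (orbit_rel Q N)"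
proof -
  interpret act: group_action "LMlt Q" "carrier Q" "\<lambda>g. g" by (rule group_action_LMlt)
  interpret N: normal N "LMlt Q" by (rule assms)
  have N1: "\<one>\<^bsub>LMlt Q\<^esub> \<in> N" by (rule subgroup.one_closed[OF N.subgroup_axioms])
  note Nm = subgroup.m_closed[OF N.subgroup_axioms]
  note Ni = subgroup.m_inv_closed[OF N.subgroup_axioms]
  let ?r = "orbit_rel Q N"
  let ?G = "LMlt Q"
  have r: "(x, y) \<in> ?r \<longleftrightarrow> x \<in> carrier Q \<and> y \<in> carrier Q \<and> (\<exists>n\<in>N. y = n x)" for x y
    by (auto simp: orbit_rel_def orbit_def)
  have NG: "n \<in> carrier ?G" if "n \<in> N" for n using that by (rule N.mem_carrier)
  have c: "g x \<in> carrier Q" if "g \<in> carrier ?G" "x \<in> carrier Q" for g x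
    using act.element_image that by blast
  have m: "(g \<otimes>\<^bsub>?G\<^esub> h) x = g (h x)"
    if "g \<in> carrier ?G" "h \<in> carrier ?G" "x \<in> carrier Q" for g h x
    using act.composition_rule that by blast
  have one: "\<one>\<^bsub>?G\<^esub> x = x" if "x \<in> carrier Q" for x
    using that by (simp add: LMlt_def BijGroup_def)
  have inv: "(inv\<^bsub>?G\<^esub> g) (g x) = x" "g ((inv\<^bsub>?G\<^esub> g) x) = x"
    if "g \<in> carrier ?G" "x \<in> carrier Q" for g x
    using m[of "inv\<^bsub>?G\<^esub> g" g x] m[of g "inv\<^bsub>?G\<^esub> g" x] that one[OF that(2)] by auto
  have LG: "ltrans Q x \<in> carrier ?G" if "x \<in> carrier Q" for x
    using that by (auto simp: LMlt_def intro: generate.incl)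
  have L: "ltrans Q x y = x \<star> y" if "y \<in> carrier Q" for x y
    using that by (simp add: ltrans_def)
  have "equiv (carrier Q) ?r"
  proof (rule equivI)
    show "?r \<subseteq> carrier Q \<times> carrier Q" by (auto simp: orbit_rel_def)
    show "refl_on (carrier Q) ?r"
    proof (rule refl_onI)
      fix x assume x: "x \<in> carrier Q"
      have "\<exists>n\<in>N. x = n x" by (rule bexI[of _ "\<one>\<^bsub>?G\<^esub>"]) (simp_all add: one x N1)
      then show "(x, x) \<in> ?r" using x by (simp add: r)
    qed
    show "sym ?r"
    proof (rule symI)
      fix x y assume "(x, y) \<in> ?r"
      then obtain n where n: "n \<in> N" "y = n x" "x \<in> carrier Q" "y \<in> carrier Q" by (auto simp: r)
      then have "x = (inv\<^bsub>?G\<^esub> n) y" by (simp add: inv NG)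
      then show "(y, x) \<in> ?r" using n Ni by (auto simp: r)
    qed
    show "trans ?r"
    proof (rule transI)
      fix x y z assume "(x, y) \<in> ?r" "(y, z) \<in> ?r"
      then obtain n k where n: "n \<in> N" "y = n x" "k \<in> N" "z = k y"
          "x \<in> carrier Q" "z \<in> carrier Q"
        by (auto simp: r)
      then have "z = (k \<otimes>\<^bsub>?G\<^esub> n) x" by (simp add: m NG)
      then show "(x, z) \<in> ?r" using n Nm by (auto simp: r)
    qed
  qed
  moreover have "(x \<star> y, n x \<star> k y) \<in> ?r \<and> (x \<setminus> y, n x \<setminus> k y) \<in> ?r"
    if n: "n \<in> N" and k: "k \<in> N" and x: "x \<in> carrier Q" and y: "y \<in> carrier Q" for n k x y
  proof -
    let ?L = "ltrans Q x"
    define p where "p = inv\<^bsub>?G\<^esub> n \<otimes>\<^bsub>?G\<^esub> k"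
    have p: "p \<in> N" using n k by (simp add: p_def Nm Ni)
    have py: "k y = n (p y)"
      using n k y by (simp add: p_def m NG inv c)
    define u where "u = ?L \<otimes>\<^bsub>?G\<^esub> p \<otimes>\<^bsub>?G\<^esub> inv\<^bsub>?G\<^esub> ?L"
    define v where "v = inv\<^bsub>?G\<^esub> ?L \<otimes>\<^bsub>?G\<^esub> p \<otimes>\<^bsub>?G\<^esub> ?L"
    have uv: "u \<in> N" "v \<in> N"
      unfolding u_def v_def using N.inv_op_closed1 N.inv_op_closed2 LG[OF x] p by auto
    have iL: "(inv\<^bsub>?G\<^esub> ?L) (x \<star> z) = z" if "z \<in> carrier Q" for z
      using inv(1)[OF LG[OF x] that] by (simp add: L that)
    have "n x \<star> k y = n (x \<star> p y)"
      using LMlt_lmult[OF NG[OF n] x c[OF NG[OF p] y]] by (simp add: py)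
    also have "x \<star> p y = u (x \<star> y)"
      using x y p LG[OF x] by (simp add: u_def m NG iL c lmult_closed L)
    also have "n (u (x \<star> y)) = (n \<otimes>\<^bsub>?G\<^esub> u) (x \<star> y)"
      using n uv x y by (simp add: m NG lmult_closed)
    finally have 1: "n x \<star> k y = (n \<otimes>\<^bsub>?G\<^esub> u) (x \<star> y)" .
    let ?z = "x \<setminus> y"
    have z: "?z \<in> carrier Q" using x y by (rule ldiv_closed)
    have vz: "v ?z \<in> carrier Q" using c[OF NG z] uv by simp
    have "x \<star> v ?z = p y"
      using z p LG[OF x] inv(2)[OF LG[OF x] c[OF NG[OF p] y]] x y L[OF vz, symmetric]
      by (simp add: v_def m NG L lmult_ldiv c)
    then have "n x \<star> n (v ?z) = k y"
      using LMlt_lmult[OF NG[OF n] x vz] py by simp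
    then have "n x \<setminus> k y = n (v ?z)"
      using ldiv_lmult[OF c[OF NG[OF n] x] c[OF NG[OF n] vz]] by simp
    then have 2: "n x \<setminus> k y = (n \<otimes>\<^bsub>?G\<^esub> v) ?z"
      using n uv z by (simp add: m NG)
    show ?thesis
      unfolding r using 1 2 n k uv x y c NG
      by (auto simp: lmult_closed ldiv_closed intro: bexI[OF _ Nm])
  qed
  ultimately show ?thesis
    unfolding lq_congruence_def by (auto simp: r)
qed


section \<open>Abelian and central extensions\<close>

text \<open>The abelian group \<open>A\<close> is written multiplicatively. Elements of \<^term>\<open>hom A A\<close> are not
  extensional, so two endomorphisms are identified when they agree on \<^term>\<open>carrier A\<close>.\<close>

locale abelian_extension = left_quasigroup Q + comm_group A
  for Q :: "('a, 'c) left_quasigroup_scheme"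
    and A :: "('b, 'd) monoid_scheme" (structure) +
  fixes \<phi> \<psi> :: "'a \<Rightarrow> 'a \<Rightarrow> 'b \<Rightarrow> 'b" and \<theta> :: "'a \<Rightarrow> 'a \<Rightarrow> 'b"
  assumes phi: "\<lbrakk>a \<in> carrier Q; b \<in> carrier Q\<rbrakk> \<Longrightarrow> \<phi> a b \<in> hom A A"
    and psi: "\<lbrakk>a \<in> carrier Q; b \<in> carrier Q\<rbrakk> \<Longrightarrow> \<psi> a b \<in> iso A A"
    and theta: "\<lbrakk>a \<in> carrier Q; b \<in> carrier Q\<rbrakk> \<Longrightarrow> \<theta> a b \<in> carrier A"

locale central_extension = abelian_extension +
  assumes phi_const:
      "\<lbrakk>a \<in> carrier Q; b \<in> carrier Q; c \<in> carrier Q; d \<in> carrier Q; s \<in> carrier A\<rbrakk>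
        \<Longrightarrow> \<phi> a b s = \<phi> c d s"
    and psi_const:
      "\<lbrakk>a \<in> carrier Q; b \<in> carrier Q; c \<in> carrier Q; d \<in> carrier Q; s \<in> carrier A\<rbrakk>
        \<Longrightarrow> \<psi> a b s = \<psi> c d s"

text \<open>The left division is the one forced by the multiplication: solve
  \<open>(a, s) * (a \ b, u) = (b, t)\<close> for \<open>u\<close>.\<close>

definition extension ::
    "('a, 'c) left_quasigroup_scheme \<Rightarrow> ('b, 'd) monoid_scheme \<Rightarrow>
     ('a \<Rightarrow> 'a \<Rightarrow> 'b \<Rightarrow> 'b) \<Rightarrow> ('a \<Rightarrow> 'a \<Rightarrow> 'b \<Rightarrow> 'b) \<Rightarrow> ('a \<Rightarrow> 'a \<Rightarrow> 'b) \<Rightarrow>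
     ('a \<times> 'b) left_quasigroup"
  where "extension Q A \<phi> \<psi> \<theta> =
    \<lparr>carrier = carrier Q \<times> carrier A,
     lmult = (\<lambda>(a, s) (b, t). (a \<star>\<^bsub>Q\<^esub> b, \<phi> a b s \<otimes>\<^bsub>A\<^esub> \<psi> a b t \<otimes>\<^bsub>A\<^esub> \<theta> a b)),
     ldiv = (\<lambda>(a, s) (b, t). let c = a \<setminus>\<^bsub>Q\<^esub> b in
       (c, inv_into (carrier A) (\<psi> a c) (t \<otimes>\<^bsub>A\<^esub> inv\<^bsub>A\<^esub> (\<phi> a c s \<otimes>\<^bsub>A\<^esub> \<theta> a c))))\<rparr>"

lemma (in abelian_extension) left_quasigroup_extension:
  "left_quasigroup (extension Q A \<phi> \<psi> \<theta>)"
proof -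
  have ph: "\<phi> a b s \<in> carrier A"
    if "a \<in> carrier Q" "b \<in> carrier Q" "s \<in> carrier A" for a b s
    using phi[OF that(1,2)] that(3) by (auto simp: hom_def)
  have bij: "bij_betw (\<psi> a b) (carrier A) (carrier A)"
    if "a \<in> carrier Q" "b \<in> carrier Q" for a b
    using psi[OF that] by (simp add: iso_def)
  have ps: "\<psi> a b s \<in> carrier A" "inv_into (carrier A) (\<psi> a b) s \<in> carrier A"
      "inv_into (carrier A) (\<psi> a b) (\<psi> a b s) = s"
      "\<psi> a b (inv_into (carrier A) (\<psi> a b) s) = s"
    if "a \<in> carrier Q" "b \<in> carrier Q" "s \<in> carrier A" for a b s
    using bij[OF that(1,2)] that(3)
    by (auto simp: bij_betw_def inv_into_into f_inv_into_f)
  have c1: "p \<otimes> x \<otimes> h \<otimes> inv (p \<otimes> h) = x"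
    if "p \<in> carrier A" "x \<in> carrier A" "h \<in> carrier A" for p x h
    using that by (metis m_assoc m_comm m_closed inv_closed r_inv r_one)
  have c2: "p \<otimes> (x \<otimes> inv (p \<otimes> h)) \<otimes> h = x"
    if "p \<in> carrier A" "x \<in> carrier A" "h \<in> carrier A" for p x h
  proof -
    have "p \<otimes> (x \<otimes> i) \<otimes> h = x \<otimes> ((p \<otimes> h) \<otimes> i)" if "i \<in> carrier A" for i
      using that \<open>p \<in> carrier A\<close> \<open>x \<in> carrier A\<close> \<open>h \<in> carrier A\<close> by (simp add: m_ac)
    then show ?thesis using that by simp
  qed
  show ?thesis
    by (unfold_locales)
      (use nonempty one_closed in
        \<open>auto simp: extension_def Let_def lmult_closed ldiv_closed ldiv_lmult lmult_ldiv
           ph ps theta c1 c2\<close>)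
qed

end

theory Submission
  imports Defs
begin

text \<open>
  Why the theorem holds. In a quandle \<open>x\<close> is fixed by its own translation, so
  \<open>a \<star> x = L\<^sub>a L\<^sub>x\<inverse> x\<close>: moving a point by a translation can always be done by a displacement.
  Connectedness of the quotient therefore says that displacements move any \<open>N\<close>-orbit to any
  other one, and because \<open>N\<close> itself consists of displacements, \<open>Dis E\<close> is transitive on \<open>E\<close>
  (\<open>Dis_transitive\<close>). A central subgroup of a transitive permutation group acts freely
  (\<open>N_free\<close>), so every \<open>N\<close>-orbit is a torsor under \<open>N\<close>, and \<open>A = N\<close> is the fibre of the
  extension.

  Choose a base point \<open>s a\<close> in each orbit \<open>a\<close>. Then \<open>(a, n) \<mapsto> n (s a)\<close> is a bijection from
  \<open>(E/\<O>\<^sub>N) \<times> N\<close> onto \<open>E\<close>. Elements of \<open>N\<close> are automorphisms of \<open>E\<close>, hence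
  \<open>n x \<star> m y = n (x \<star> (n\<inverse> m) y) = n c(n\<inverse>) c(m) (x \<star> y)\<close>, where \<open>c\<close> is conjugation by
  \<open>L\<^sub>x\<close>. Two translations differ by a displacement, which centralizes \<open>N\<close>; so \<open>c\<close> does not
  depend on \<open>x\<close> (\<open>lmult_N\<close>), and this is what makes the extension central:
  \<open>\<psi> = c\<close> and \<open>\<phi> = (n \<mapsto> n c(n\<inverse>))\<close> are constant. The cocycle \<open>\<theta> a b\<close> measures the failure of
  the base points to be closed under \<open>\<star>\<close>.
\<close>

section \<open>Quotients and isomorphisms of left quasigroups\<close>

lemma (in left_quasigroup) left_quasigroup_quotient:
  assumes "lq_congruence Q r"
  shows "left_quasigroup (lq_quotient Q r)"
proof -
  have carrier: "carrier (lq_quotient Q r) = carrier Q // r"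
    by (simp add: lq_quotient_def)
  show ?thesis
  proof (unfold_locales, unfold carrier)
    show "carrier Q // r \<noteq> {}"
      using nonempty by (auto simp: quotient_def)
  qed (auto elim!: quotientE intro!: quotientI
      simp: lq_quotient_lmult[OF assms] lq_quotient_ldiv[OF assms]
        lmult_closed ldiv_closed ldiv_lmult lmult_ldiv)
qed

text \<open>Left division is determined by multiplication, so it need not be checked separately.\<close>

lemma lq_isoI:
  assumes Q: "left_quasigroup Q" and R: "left_quasigroup R"
    and h: "bij_betw h (carrier Q) (carrier R)"
    and mult: "\<And>x y. \<lbrakk>x \<in> carrier Q; y \<in> carrier Q\<rbrakk> \<Longrightarrow> h (x \<star>\<^bsub>Q\<^esub> y) = h x \<star>\<^bsub>R\<^esub> h y"
  shows "h \<in> lq_iso Q R"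
proof -
  interpret Q: left_quasigroup Q by (rule Q)
  interpret R: left_quasigroup R by (rule R)
  have "h (x \<setminus>\<^bsub>Q\<^esub> y) = h x \<setminus>\<^bsub>R\<^esub> h y" if "x \<in> carrier Q" "y \<in> carrier Q" for x y
  proof -
    have "h x \<star>\<^bsub>R\<^esub> h (x \<setminus>\<^bsub>Q\<^esub> y) = h y"
      using that by (simp flip: mult add: Q.ldiv_closed Q.lmult_ldiv)
    then show ?thesis
      using R.ldiv_lmult bij_betwE[OF h] Q.ldiv_closed that by metis
  qed
  then show ?thesis
    using h mult by (simp add: lq_iso_def)
qed

lemma lq_iso_inv:
  assumes Q: "left_quasigroup Q" and R: "left_quasigroup R" and h: "h \<in> lq_iso Q R"
  shows "inv_into (carrier Q) h \<in> lq_iso R Q"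
proof (rule lq_isoI[OF R Q])
  let ?k = "inv_into (carrier Q) h"
  have bij: "bij_betw h (carrier Q) (carrier R)"
    and mult: "\<And>x y. \<lbrakk>x \<in> carrier Q; y \<in> carrier Q\<rbrakk> \<Longrightarrow> h (x \<star>\<^bsub>Q\<^esub> y) = h x \<star>\<^bsub>R\<^esub> h y"
    using h by (auto simp: lq_iso_def)
  show bij': "bij_betw ?k (carrier R) (carrier Q)"
    by (rule bij_betw_inv_into[OF bij])
  fix x y assume xy: "x \<in> carrier R" "y \<in> carrier R"
  have k: "?k x \<in> carrier Q" "?k y \<in> carrier Q"
    using bij_betwE[OF bij'] xy by auto
  have "h (?k x \<star>\<^bsub>Q\<^esub> ?k y) = x \<star>\<^bsub>R\<^esub> y"
    using mult[OF k] xy by (simp add: bij_betw_inv_into_right[OF bij])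
  then show "?k (x \<star>\<^bsub>R\<^esub> y) = ?k x \<star>\<^bsub>Q\<^esub> ?k y"
    using bij_betw_inv_into_left[OF bij left_quasigroup.lmult_closed[OF Q k]] by simp
qed


section \<open>Translations and displacements as permutations\<close>

context left_quasigroup
begin

lemma group_LMlt: "group (LMlt Q)"
  using group_action_LMlt by (simp add: group_action_def group_hom_def)

lemma LMlt_closed: "\<lbrakk>g \<in> carrier (LMlt Q); x \<in> carrier Q\<rbrakk> \<Longrightarrow> g x \<in> carrier Q"
  using group_action.element_image[OF group_action_LMlt] by blast

lemma LMlt_mult:
  "\<lbrakk>g \<in> carrier (LMlt Q); h \<in> carrier (LMlt Q); x \<in> carrier Q\<rbrakk>
    \<Longrightarrow> (g \<otimes>\<^bsub>LMlt Q\<^esub> h) x = g (h x)"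
  using group_action.composition_rule[OF group_action_LMlt] by blast

lemma LMlt_one: "x \<in> carrier Q \<Longrightarrow> \<one>\<^bsub>LMlt Q\<^esub> x = x"
  by (simp add: LMlt_def BijGroup_def)

lemma LMlt_inv:
  assumes "g \<in> carrier (LMlt Q)" "x \<in> carrier Q"
  shows "(inv\<^bsub>LMlt Q\<^esub> g) (g x) = x" and "g ((inv\<^bsub>LMlt Q\<^esub> g) x) = x"
proof -
  interpret G: group "LMlt Q" by (rule group_LMlt)
  show "(inv\<^bsub>LMlt Q\<^esub> g) (g x) = x"
    using LMlt_mult[of "inv\<^bsub>LMlt Q\<^esub> g" g x] LMlt_one assms by simp
  show "g ((inv\<^bsub>LMlt Q\<^esub> g) x) = x"
    using LMlt_mult[of g "inv\<^bsub>LMlt Q\<^esub> g" x] LMlt_one assms by simp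
qed

lemma LMlt_ext:
  assumes "g \<in> carrier (LMlt Q)" "h \<in> carrier (LMlt Q)"
    and "\<And>x. x \<in> carrier Q \<Longrightarrow> g x = h x"
  shows "g = h"
proof (rule extensionalityI)
  have "carrier (LMlt Q) \<subseteq> Bij (carrier Q)"
    using subgroup.subset[OF subgroup_LMlt] by (simp add: BijGroup_def)
  then show "g \<in> extensional (carrier Q)" "h \<in> extensional (carrier Q)"
    using assms(1,2) by (auto simp: Bij_def)
qed (rule assms(3))

lemma ltrans_LMlt: "a \<in> carrier Q \<Longrightarrow> ltrans Q a \<in> carrier (LMlt Q)"
  by (auto simp: LMlt_def intro: generate.incl)

lemma ltrans_apply: "x \<in> carrier Q \<Longrightarrow> ltrans Q a x = a \<star> x"
  by (simp add: ltrans_def)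

lemma LMlt_inv_eq:
  "g \<in> carrier (LMlt Q) \<Longrightarrow> inv\<^bsub>BijGroup (carrier Q)\<^esub> g = inv\<^bsub>LMlt Q\<^esub> g"
  using group.m_inv_consistent[OF group_BijGroup subgroup_LMlt]
  by (simp add: LMlt_def)

lemma Dis_mult: "g \<otimes>\<^bsub>Dis Q\<^esub> h = g \<otimes>\<^bsub>LMlt Q\<^esub> h"
  by (simp add: Dis_def LMlt_def)

lemma Dis_gen:
  assumes "a \<in> carrier Q" "b \<in> carrier Q"
  shows "ltrans Q a \<otimes>\<^bsub>LMlt Q\<^esub> inv\<^bsub>LMlt Q\<^esub> ltrans Q b \<in> carrier (Dis Q)"
proof -
  have "ltrans Q a \<otimes>\<^bsub>BijGroup (carrier Q)\<^esub> inv\<^bsub>BijGroup (carrier Q)\<^esub> ltrans Q b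
      \<in> carrier (Dis Q)"
    using assms by (auto simp: Dis_def intro: generate.incl)
  then show ?thesis
    using LMlt_inv_eq[OF ltrans_LMlt[OF assms(2)]] by (simp add: LMlt_def)
qed

lemma subgroup_Dis: "subgroup (carrier (Dis Q)) (LMlt Q)"
proof -
  interpret B: group "BijGroup (carrier Q)" by (rule group_BijGroup)
  interpret L: subgroup "carrier (LMlt Q)" "BijGroup (carrier Q)" by (rule subgroup_LMlt)
  let ?D = "{ltrans Q a \<otimes>\<^bsub>BijGroup (carrier Q)\<^esub> inv\<^bsub>BijGroup (carrier Q)\<^esub> ltrans Q b | a b.
    a \<in> carrier Q \<and> b \<in> carrier Q}"
  have D: "?D \<subseteq> carrier (LMlt Q)"
    using ltrans_LMlt L.m_closed L.m_inv_closed by auto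
  then have "subgroup (carrier (Dis Q)) (BijGroup (carrier Q))"
    and "carrier (Dis Q) \<subseteq> carrier (LMlt Q)"
    using B.generate_is_subgroup[of ?D] B.generate_subgroup_incl[OF D subgroup_LMlt] L.subset
    by (auto simp: Dis_def)
  from B.subgroup_incl[OF this(1) subgroup_LMlt this(2)]
  show ?thesis by (simp add: LMlt_def)
qed

end

text \<open>Since \<open>L\<^sub>x\<close> fixes \<open>x\<close>, a translation and a displacement have the same effect at \<open>x\<close>.\<close>

lemma (in quandle) lmult_by_displacement:
  assumes "a \<in> carrier Q" "x \<in> carrier Q"
  shows "(ltrans Q a \<otimes>\<^bsub>LMlt Q\<^esub> inv\<^bsub>LMlt Q\<^esub> ltrans Q x) x = a \<star> x"
proof -
  interpret G: group "LMlt Q" by (rule group_LMlt)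
  note L = ltrans_LMlt[OF assms(1)] ltrans_LMlt[OF assms(2)]
  have "(inv\<^bsub>LMlt Q\<^esub> ltrans Q x) x = x"
    using LMlt_inv(1)[OF L(2) assms(2)] assms by (simp add: ltrans_apply idem)
  then show ?thesis
    using L assms by (simp add: LMlt_mult ltrans_apply)
qed

text \<open>This lifts the action of the multiplication group of a quotient to displacements of the
  quandle itself. The displacement depends on the point, which is harmless for transitivity.\<close>

lemma (in quandle) LMlt_quotient_by_displacement:
  assumes r: "lq_congruence Q r"
    and "g \<in> carrier (LMlt (lq_quotient Q r))" and "x \<in> carrier Q"
  shows "\<exists>d\<in>carrier (Dis Q). g (r `` {x}) = r `` {d x}"
proof -
  let ?Q = "lq_quotient Q r"
  let ?B = "BijGroup (carrier ?Q)"
  interpret q: left_quasigroup ?Q by (rule left_quasigroup_quotient[OF r])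
  interpret G: group "LMlt Q" by (rule group_LMlt)
  interpret D: subgroup "carrier (Dis Q)" "LMlt Q" by (rule subgroup_Dis)
  have cls: "r `` {x} \<in> carrier ?Q" if "x \<in> carrier Q" for x
    using that by (simp add: lq_quotient_def quotientI)
  have gen: "generate ?B {ltrans ?Q a |a. a \<in> carrier ?Q} = carrier (LMlt ?Q)"
    by (simp add: LMlt_def)
  have "g \<in> generate ?B {ltrans ?Q a |a. a \<in> carrier ?Q}"
    using assms(2) by (simp add: gen)
  then show ?thesis
    using assms(3)
  proof (induction arbitrary: x)
    case one
    then have "\<one>\<^bsub>?B\<^esub> (r `` {x}) = r `` {\<one>\<^bsub>LMlt Q\<^esub> x}"
      by (simp add: LMlt_one BijGroup_def cls)
    then show ?case using D.one_closed by (rule bexI)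
  next
    case (incl h)
    then obtain a where a: "a \<in> carrier Q" "h = ltrans ?Q (r `` {a})"
      by (auto simp: lq_quotient_def elim!: quotientE)
    let ?d = "ltrans Q a \<otimes>\<^bsub>LMlt Q\<^esub> inv\<^bsub>LMlt Q\<^esub> ltrans Q x"
    have "h (r `` {x}) = r `` {?d x}"
      using a incl(2) by (simp add: q.ltrans_apply cls lq_quotient_lmult[OF r]
          lmult_by_displacement)
    then show ?case using Dis_gen[OF a(1) incl(2)] by blast
  next
    case (inv h)
    then obtain a where a: "a \<in> carrier Q" "h = ltrans ?Q (r `` {a})"
      by (auto simp: lq_quotient_def elim!: quotientE)
    let ?y = "a \<setminus> x"
    have y: "?y \<in> carrier Q" using a inv(2) by (simp add: ldiv_closed)
    \<comment> \<open>\<open>L\<^sub>a\<inverse>\<close> takes \<open>x\<close> to \<open>y = a \ x\<close>, and \<open>L\<^sub>a L\<^sub>y\<inverse>\<close> takes \<open>y\<close> back to \<open>x\<close>.\<close>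
    let ?d = "ltrans Q a \<otimes>\<^bsub>LMlt Q\<^esub> inv\<^bsub>LMlt Q\<^esub> ltrans Q ?y"
    have d: "?d \<in> carrier (Dis Q)" by (rule Dis_gen[OF a(1) y])
    have "?d ?y = x"
      using a inv(2) y by (simp add: lmult_by_displacement lmult_ldiv)
    then have dx: "(inv\<^bsub>LMlt Q\<^esub> ?d) x = ?y"
      using LMlt_inv(1)[OF D.mem_carrier[OF d] y] by simp
    have h: "h \<in> carrier (LMlt ?Q)"
      using a cls q.ltrans_LMlt by simp
    have "h (r `` {?y}) = r `` {x}"
      using a inv(2) y by (simp add: q.ltrans_apply cls lq_quotient_lmult[OF r] lmult_ldiv)
    then have "(inv\<^bsub>?B\<^esub> h) (r `` {x}) = r `` {?y}"
      using q.LMlt_inv(1)[OF h cls[OF y]] by (simp add: q.LMlt_inv_eq[OF h])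
    then show ?case
      using D.m_inv_closed[OF d] dx by metis
  next
    case (eng f h)
    obtain d where d: "d \<in> carrier (Dis Q)" "h (r `` {x}) = r `` {d x}"
      using eng by blast
    have "d x \<in> carrier Q" using d eng LMlt_closed D.mem_carrier by blast
    then obtain d' where d': "d' \<in> carrier (Dis Q)" "f (r `` {d x}) = r `` {d' (d x)}"
      using eng by blast
    have "(f \<otimes>\<^bsub>?B\<^esub> h) (r `` {x}) = r `` {(d' \<otimes>\<^bsub>LMlt Q\<^esub> d) x}"
      using q.LMlt_mult[of f h "r `` {x}"] eng cls d d'
      by (simp add: gen LMlt_mult D.mem_carrier) (simp add: LMlt_def)
    then show ?case using d d' by blast
  qed
qed


section \<open>Central subgroups of the displacement group\<close>

locale central_dis_subgroup = quandle E for E (structure) +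
  fixes N :: "('a \<Rightarrow> 'a) set"
  assumes N_Dis: "N \<subseteq> carrier (Dis E)"
    and N_normal: "N \<lhd> LMlt E"
    and N_central: "\<lbrakk>n \<in> N; g \<in> carrier (Dis E)\<rbrakk> \<Longrightarrow> n \<otimes>\<^bsub>LMlt E\<^esub> g = g \<otimes>\<^bsub>LMlt E\<^esub> n"
    and quotient_connected: "lq_connected (lq_quotient E (orbit_rel E N))"
begin

abbreviation "G \<equiv> LMlt E"
abbreviation "R \<equiv> orbit_rel E N"
abbreviation "A \<equiv> G\<lparr>carrier := N\<rparr>"

interpretation G: group G by (rule group_LMlt)
interpretation D: subgroup "carrier (Dis E)" G by (rule subgroup_Dis)
interpretation N: normal N G by (rule N_normal)

lemma N_subgroup: "subgroup N G" by (rule N.subgroup_axioms)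

lemma N_LMlt: "n \<in> N \<Longrightarrow> n \<in> carrier G"
  by (rule N.mem_carrier)

lemma N_closed: "\<lbrakk>n \<in> N; x \<in> carrier E\<rbrakk> \<Longrightarrow> n x \<in> carrier E"
  by (simp add: LMlt_closed N_LMlt)

lemma comm_group_N: "comm_group A"
proof (rule group.group_comm_groupI)
  show "group A" by (rule G.subgroup_imp_group[OF N_subgroup])
qed (use N_central N_Dis in auto)

interpretation A: comm_group A by (rule comm_group_N)

lemma mem_R: "(x, y) \<in> R \<longleftrightarrow> x \<in> carrier E \<and> y \<in> carrier E \<and> (\<exists>n\<in>N. y = n x)"
  by (auto simp: orbit_rel_def orbit_def)

lemma congruence_R: "lq_congruence E R"
  by (rule orbit_rel_congruence[OF N_normal])

lemma equiv_R: "equiv (carrier E) R"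
  using congruence_R by (simp add: lq_congruence_def)

lemma Dis_transitive:
  assumes "x \<in> carrier E" "y \<in> carrier E"
  obtains d where "d \<in> carrier (Dis E)" "d x = y"
proof -
  interpret q: left_quasigroup "lq_quotient E R"
    by (rule left_quasigroup_quotient[OF congruence_R])
  have "R `` {x} \<in> carrier (lq_quotient E R)" "R `` {y} \<in> carrier (lq_quotient E R)"
    using assms by (simp_all add: lq_quotient_def quotientI)
  then obtain g where "g \<in> carrier (LMlt (lq_quotient E R))" "g (R `` {x}) = R `` {y}"
    using quotient_connected q.lq_connected_iff by blast
  then obtain d where d: "d \<in> carrier (Dis E)" "R `` {y} = R `` {d x}"
    using LMlt_quotient_by_displacement[OF congruence_R _ assms(1)] by metis
  then have "(d x, y) \<in> R"
    using eq_equiv_class[OF d(2)[symmetric] equiv_R assms(2)] by simp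
  then obtain n where n: "n \<in> N" "y = n (d x)"
    by (auto simp: mem_R)
  \<comment> \<open>The correction within the orbit is again a displacement, because \<open>N \<subseteq> Dis E\<close>.\<close>
  have "(n \<otimes>\<^bsub>G\<^esub> d) x = y"
    using n d assms by (simp add: LMlt_mult D.mem_carrier N_LMlt)
  then show thesis
    using that[of "n \<otimes>\<^bsub>G\<^esub> d"] n d N_Dis by blast
qed

text \<open>An element of \<open>N\<close> fixing one point \<open>x\<close> fixes every \<open>d x\<close> with \<open>d\<close> a displacement, because
  it commutes with \<open>d\<close>; by transitivity these are all the points.\<close>

lemma N_fixed_point:
  assumes n: "n \<in> N" and x: "x \<in> carrier E" and fixed: "n x = x"
  shows "n = \<one>\<^bsub>G\<^esub>"
proof (rule LMlt_ext)
  fix y assume y: "y \<in> carrier E"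
  obtain d where d: "d \<in> carrier (Dis E)" "d x = y"
    using Dis_transitive[OF x y] .
  have "n y = (n \<otimes>\<^bsub>G\<^esub> d) x"
    using d n x by (simp add: LMlt_mult D.mem_carrier N_LMlt)
  also have "\<dots> = (d \<otimes>\<^bsub>G\<^esub> n) x"
    using N_central[OF n d(1)] by simp
  also have "\<dots> = y"
    using d n x fixed by (simp add: LMlt_mult D.mem_carrier N_LMlt)
  finally show "n y = \<one>\<^bsub>G\<^esub> y"
    using y by (simp add: LMlt_one)
qed (use n in \<open>simp_all add: N_LMlt\<close>)

lemma N_free:
  assumes "n \<in> N" "m \<in> N" "x \<in> carrier E" "n x = m x"
  shows "n = m"
proof -
  have "(inv\<^bsub>G\<^esub> m \<otimes>\<^bsub>G\<^esub> n) x = x"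
    using assms by (simp add: LMlt_mult N_LMlt LMlt_inv)
  then have "inv\<^bsub>G\<^esub> m \<otimes>\<^bsub>G\<^esub> n = \<one>\<^bsub>G\<^esub>"
    using N_fixed_point assms by simp
  then show ?thesis
    using assms by (metis G.inv_closed G.inv_equality G.inv_inv N_LMlt)
qed


section \<open>The conjugation action of translations\<close>

text \<open>Conjugation by any other translation has the same effect on \<open>N\<close>, see \<open>conj_N_eq\<close>; one is
  singled out so that the map carries no parameter from \<open>E\<close>.\<close>

definition conj_N :: "('a \<Rightarrow> 'a) \<Rightarrow> 'a \<Rightarrow> 'a" where
  "conj_N n = (let L = ltrans E (SOME x. x \<in> carrier E) in L \<otimes>\<^bsub>G\<^esub> n \<otimes>\<^bsub>G\<^esub> inv\<^bsub>G\<^esub> L)"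

text \<open>Conjugation by the base translation is conjugation by \<open>L\<^sub>x\<close> followed by conjugation by
  the displacement between the two, and the latter is trivial on \<open>N\<close>.\<close>

lemma conj_N_eq:
  assumes x: "x \<in> carrier E" and n: "n \<in> N"
  shows "conj_N n = ltrans E x \<otimes>\<^bsub>G\<^esub> n \<otimes>\<^bsub>G\<^esub> inv\<^bsub>G\<^esub> ltrans E x"
proof -
  define y where "y = (SOME x. x \<in> carrier E)"
  have y: "y \<in> carrier E" using x unfolding y_def by (rule someI)
  let ?K = "ltrans E y" and ?L = "ltrans E x"
  have L: "?K \<in> carrier G" "?L \<in> carrier G" "n \<in> carrier G"
    using x y n by (auto simp: ltrans_LMlt N_LMlt)
  let ?d = "?K \<otimes>\<^bsub>G\<^esub> inv\<^bsub>G\<^esub> ?L" and ?m = "?L \<otimes>\<^bsub>G\<^esub> n \<otimes>\<^bsub>G\<^esub> inv\<^bsub>G\<^esub> ?L"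
  have m: "?m \<in> N" by (rule N.inv_op_closed2[OF L(2) n])
  have "?K \<otimes>\<^bsub>G\<^esub> n = ?d \<otimes>\<^bsub>G\<^esub> ?m \<otimes>\<^bsub>G\<^esub> ?L"
    using L by (simp add: G.m_assoc G.inv_solve_left')
      (metis G.m_assoc G.inv_closed G.l_inv G.l_one G.m_closed)
  also have "\<dots> = ?m \<otimes>\<^bsub>G\<^esub> ?d \<otimes>\<^bsub>G\<^esub> ?L"
    using N_central[OF m Dis_gen[OF y x]] by simp
  also have "\<dots> = ?m \<otimes>\<^bsub>G\<^esub> ?K"
    using L by (simp add: G.m_assoc)
  finally have "?K \<otimes>\<^bsub>G\<^esub> n \<otimes>\<^bsub>G\<^esub> inv\<^bsub>G\<^esub> ?K = ?m"
    using L by (simp add: G.m_assoc)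
  then show ?thesis
    by (simp add: conj_N_def Let_def flip: y_def)
qed

lemma lmult_N:
  assumes "x \<in> carrier E" "y \<in> carrier E" "n \<in> N"
  shows "x \<star> n y = conj_N n (x \<star> y)"
  using assms LMlt_inv(1)[OF ltrans_LMlt[OF assms(1)] assms(2)]
  by (simp add: conj_N_eq[OF assms(1,3)] LMlt_mult ltrans_LMlt N_LMlt N_closed lmult_closed
      ltrans_apply)

lemma conj_N_iso: "conj_N \<in> iso A A"
proof -
  obtain x where x: "x \<in> carrier E" using nonempty by blast
  let ?L = "ltrans E x"
  have L: "?L \<in> carrier G" by (rule ltrans_LMlt[OF x])
  note eq = conj_N_eq[OF x]
  have "conj_N \<in> hom A A"
  proof (rule homI)
    show "conj_N n \<in> carrier A" if "n \<in> carrier A" for n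
      using that N.inv_op_closed2[OF L] by (simp add: eq)
    show "conj_N (n \<otimes>\<^bsub>A\<^esub> m) = conj_N n \<otimes>\<^bsub>A\<^esub> conj_N m"
      if "n \<in> carrier A" "m \<in> carrier A" for n m
    proof -
      have nm: "n \<in> N" "m \<in> N" "n \<otimes>\<^bsub>G\<^esub> m \<in> N" using that by auto
      have "inv\<^bsub>G\<^esub> ?L \<otimes>\<^bsub>G\<^esub> (?L \<otimes>\<^bsub>G\<^esub> z) = z" if "z \<in> carrier G" for z
        using that L by (simp flip: G.m_assoc)
      then show ?thesis
        using nm L by (simp add: eq G.m_assoc N_LMlt)
    qed
  qed
  moreover have "bij_betw conj_N N N"
  proof (rule bij_betwI[where g = "\<lambda>n. inv\<^bsub>G\<^esub> ?L \<otimes>\<^bsub>G\<^esub> n \<otimes>\<^bsub>G\<^esub> ?L"])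
    show "conj_N \<in> N \<rightarrow> N"
      using N.inv_op_closed2[OF L] by (simp add: eq)
    show "(\<lambda>n. inv\<^bsub>G\<^esub> ?L \<otimes>\<^bsub>G\<^esub> n \<otimes>\<^bsub>G\<^esub> ?L) \<in> N \<rightarrow> N"
      using N.inv_op_closed1[OF L] by simp
    show "inv\<^bsub>G\<^esub> ?L \<otimes>\<^bsub>G\<^esub> conj_N n \<otimes>\<^bsub>G\<^esub> ?L = n" if "n \<in> N" for n
    proof -
      have "inv\<^bsub>G\<^esub> ?L \<otimes>\<^bsub>G\<^esub> (?L \<otimes>\<^bsub>G\<^esub> z) = z" if "z \<in> carrier G" for z
        using that L by (simp flip: G.m_assoc)
      then show ?thesis
        using that L by (simp add: eq G.m_assoc N_LMlt)
    qed
    show "conj_N (inv\<^bsub>G\<^esub> ?L \<otimes>\<^bsub>G\<^esub> n \<otimes>\<^bsub>G\<^esub> ?L) = n" if "n \<in> N" for n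
    proof -
      have "?L \<otimes>\<^bsub>G\<^esub> (inv\<^bsub>G\<^esub> ?L \<otimes>\<^bsub>G\<^esub> z) = z" if "z \<in> carrier G" for z
        using that L by (simp flip: G.m_assoc)
      then show ?thesis
        using that L N.inv_op_closed1[OF L that] by (simp add: eq G.m_assoc N_LMlt)
    qed
  qed
  ultimately show ?thesis by (simp add: iso_def)
qed

lemma conj_N_closed: "n \<in> N \<Longrightarrow> conj_N n \<in> N"
  using conj_N_iso by (auto simp: iso_def hom_def)

lemma conj_N_mult: "\<lbrakk>n \<in> N; m \<in> N\<rbrakk> \<Longrightarrow> conj_N (n \<otimes>\<^bsub>G\<^esub> m) = conj_N n \<otimes>\<^bsub>G\<^esub> conj_N m"
  using conj_N_iso by (auto simp: iso_def hom_def)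

definition commutator_N :: "('a \<Rightarrow> 'a) \<Rightarrow> 'a \<Rightarrow> 'a" where
  "commutator_N n = n \<otimes>\<^bsub>G\<^esub> conj_N (inv\<^bsub>G\<^esub> n)"

lemma commutator_N_hom: "commutator_N \<in> hom A A"
proof (rule homI)
  show "commutator_N n \<in> carrier A" if "n \<in> carrier A" for n
    using that by (simp add: commutator_N_def conj_N_closed)
  show "commutator_N (n \<otimes>\<^bsub>A\<^esub> m) = commutator_N n \<otimes>\<^bsub>A\<^esub> commutator_N m"
    if "n \<in> carrier A" "m \<in> carrier A" for n m
  proof -
    have nm: "n \<in> N" "m \<in> N" using that by auto
    define n' m' where "n' = conj_N (inv\<^bsub>G\<^esub> n)" and "m' = conj_N (inv\<^bsub>G\<^esub> m)"
    have nm': "n' \<in> N" "m' \<in> N"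
      using nm by (simp_all add: n'_def m'_def conj_N_closed)
    have "conj_N (inv\<^bsub>G\<^esub> (n \<otimes>\<^bsub>G\<^esub> m)) = m' \<otimes>\<^bsub>G\<^esub> n'"
      using nm by (simp add: G.inv_mult_group N_LMlt conj_N_mult n'_def m'_def)
    moreover have "n \<otimes>\<^bsub>A\<^esub> m \<otimes>\<^bsub>A\<^esub> (m' \<otimes>\<^bsub>A\<^esub> n') = n \<otimes>\<^bsub>A\<^esub> n' \<otimes>\<^bsub>A\<^esub> (m \<otimes>\<^bsub>A\<^esub> m')"
      using A.m_ac nm nm' by simp
    ultimately show ?thesis
      by (simp add: commutator_N_def n'_def m'_def)
  qed
qed

text \<open>The reason for the shape of \<open>commutator_N\<close>: as \<open>n\<close> is an automorphism, it can be pulled out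
  of the product on the left, leaving \<open>n\<inverse> m\<close> to be moved past \<open>L\<^sub>x\<close>.\<close>

lemma lmult_N_N:
  assumes "x \<in> carrier E" "y \<in> carrier E" "n \<in> N" "m \<in> N"
  shows "n x \<star> m y = (commutator_N n \<otimes>\<^bsub>G\<^esub> conj_N m) (x \<star> y)"
proof -
  let ?k = "inv\<^bsub>G\<^esub> n \<otimes>\<^bsub>G\<^esub> m"
  have k: "?k \<in> N" using assms by simp
  have "n x \<star> m y = n x \<star> n (?k y)"
    using assms by (simp add: LMlt_mult N_LMlt N_closed LMlt_inv)
  also have "\<dots> = n (x \<star> ?k y)"
    using LMlt_lmult[OF N_LMlt[OF assms(3)] assms(1) N_closed[OF k assms(2)]] by simp
  also have "\<dots> = n (conj_N ?k (x \<star> y))"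
    using lmult_N[OF assms(1,2) k] by simp
  also have "\<dots> = (commutator_N n \<otimes>\<^bsub>G\<^esub> conj_N m) (x \<star> y)"
    using assms by (simp add: conj_N_mult commutator_N_def LMlt_mult N_LMlt N_closed
        lmult_closed conj_N_closed)
  finally show ?thesis .
qed


section \<open>Coordinates on the orbits\<close>

definition base_point :: "'a set \<Rightarrow> 'a" where
  "base_point a = (SOME x. x \<in> a)"

text \<open>Products of base points need not be base points; the cocycle records the difference.\<close>

definition cocycle :: "'a set \<Rightarrow> 'a set \<Rightarrow> 'a \<Rightarrow> 'a" where
  "cocycle a b = (SOME n. n \<in> N \<and>
     base_point a \<star> base_point b = n (base_point (a \<star>\<^bsub>lq_quotient E R\<^esub> b)))"

lemma carrier_quotient: "carrier (lq_quotient E R) = carrier E // R"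
  by (simp add: lq_quotient_def)

lemma base_point:
  assumes "a \<in> carrier E // R"
  shows "base_point a \<in> carrier E" "R `` {base_point a} = a"
proof -
  obtain x where x: "x \<in> a"
    using assms in_quotient_imp_non_empty[OF equiv_R] by blast
  have s: "base_point a \<in> a"
    unfolding base_point_def using x by (rule someI)
  then show "base_point a \<in> carrier E"
    using assms in_quotient_imp_subset[OF equiv_R] by blast
  obtain y where y: "a = R `` {y}"
    using assms by (rule quotientE)
  then have "(y, base_point a) \<in> R"
    using s by simp
  then have "R `` {y} = R `` {base_point a}"
    by (rule equiv_class_eq[OF equiv_R])
  with y show "R `` {base_point a} = a"
    by (rule trans[THEN sym])
qed

lemma orbit_coordinate:
  assumes "x \<in> carrier E"
  obtains n where "n \<in> N" "x = n (base_point (R `` {x}))"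
proof -
  have a: "R `` {x} \<in> carrier E // R" using assms by (rule quotientI)
  then have "(base_point (R `` {x}), x) \<in> R"
    using base_point[OF a] eq_equiv_class[OF _ equiv_R assms] by metis
  then show thesis using that by (auto simp: mem_R)
qed

lemma cocycle:
  assumes "a \<in> carrier E // R" "b \<in> carrier E // R"
  shows "cocycle a b \<in> N"
    and "base_point a \<star> base_point b
      = cocycle a b (base_point (a \<star>\<^bsub>lq_quotient E R\<^esub> b))"
proof -
  let ?x = "base_point a \<star> base_point b"
  have "?x \<in> carrier E"
    using assms by (simp add: base_point lmult_closed)
  moreover have "a \<star>\<^bsub>lq_quotient E R\<^esub> b = R `` {?x}"
    using lq_quotient_lmult[OF congruence_R base_point(1)[OF assms(1)]
        base_point(1)[OF assms(2)]] assms
    by (simp add: base_point)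
  ultimately have "\<exists>n. n \<in> N \<and> ?x = n (base_point (a \<star>\<^bsub>lq_quotient E R\<^esub> b))"
    using orbit_coordinate[of ?x] by auto
  from someI_ex[OF this] show "cocycle a b \<in> N"
    and "?x = cocycle a b (base_point (a \<star>\<^bsub>lq_quotient E R\<^esub> b))"
    by (auto simp: cocycle_def)
qed

lemma class_N:
  assumes "a \<in> carrier E // R" "n \<in> N"
  shows "R `` {n (base_point a)} = a"
proof -
  have "(base_point a, n (base_point a)) \<in> R"
    using assms by (auto simp: mem_R base_point N_closed)
  then show ?thesis
    using equiv_class_eq[OF equiv_R] base_point(2)[OF assms(1)] by metis
qed

lemma bij_coordinates:
  "bij_betw (\<lambda>(a, n). n (base_point a)) ((carrier E // R) \<times> N) (carrier E)"
proof (rule bij_betw_imageI)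
  show "inj_on (\<lambda>(a, n). n (base_point a)) ((carrier E // R) \<times> N)"
  proof (rule inj_onI, clarify)
    fix a n b m
    assume an: "a \<in> carrier E // R" "n \<in> N" and bm: "b \<in> carrier E // R" "m \<in> N"
      and eq: "n (base_point a) = m (base_point b)"
    have "a = b" using class_N[OF an] class_N[OF bm] eq by simp
    then show "a = b \<and> n = m"
      using N_free an bm eq base_point by blast
  qed
  show "(\<lambda>(a, n). n (base_point a)) ` ((carrier E // R) \<times> N) = carrier E"
  proof
    show "carrier E \<subseteq> (\<lambda>(a, n). n (base_point a)) ` ((carrier E // R) \<times> N)"
    proof
      fix x assume x: "x \<in> carrier E"
      then obtain n where "n \<in> N" "x = n (base_point (R `` {x}))"
        by (rule orbit_coordinate)
      then show "x \<in> (\<lambda>(a, n). n (base_point a)) ` ((carrier E // R) \<times> N)"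
        using quotientI[OF x] by (intro image_eqI[where x = "(R `` {x}, n)"]) auto
    qed
  qed (auto simp: N_closed base_point)
qed

lemma central_extension_N:
  "central_extension (lq_quotient E R) A (\<lambda>_ _. commutator_N) (\<lambda>_ _. conj_N) cocycle"
proof -
  interpret q: left_quasigroup "lq_quotient E R"
    by (rule left_quasigroup_quotient[OF congruence_R])
  show ?thesis
    by unfold_locales
      (use commutator_N_hom conj_N_iso cocycle(1) in \<open>auto simp: carrier_quotient\<close>)
qed

theorem lq_isomorphic_extension_N:
  "lq_isomorphic E
     (extension (lq_quotient E R) A (\<lambda>_ _. commutator_N) (\<lambda>_ _. conj_N) cocycle)"
    (is "lq_isomorphic E ?X")
proof -
  interpret X: central_extension "lq_quotient E R" A "\<lambda>_ _. commutator_N" "\<lambda>_ _. conj_N" cocycle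
    by (rule central_extension_N)
  have carrier: "carrier ?X = (carrier E // R) \<times> N"
    by (simp add: extension_def carrier_quotient)
  have "(\<lambda>(a, n). n (base_point a)) \<in> lq_iso ?X E"
  proof (rule lq_isoI[OF X.left_quasigroup_extension left_quasigroup_axioms])
    fix p q assume "p \<in> carrier ?X" "q \<in> carrier ?X"
    then obtain a n b m where p: "p = (a, n)" "a \<in> carrier E // R" "n \<in> N"
      and q: "q = (b, m)" "b \<in> carrier E // R" "m \<in> N"
      by (auto simp: carrier)
    let ?c = "a \<star>\<^bsub>lq_quotient E R\<^esub> b"
    have c: "?c \<in> carrier E // R"
      using X.lmult_closed p q by (simp add: carrier_quotient)
    have "n (base_point a) \<star> m (base_point b)
        = (commutator_N n \<otimes>\<^bsub>G\<^esub> conj_N m) (cocycle a b (base_point ?c))"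
      using p q by (simp add: lmult_N_N base_point cocycle(2))
    also have "\<dots> = (commutator_N n \<otimes>\<^bsub>G\<^esub> conj_N m \<otimes>\<^bsub>G\<^esub> cocycle a b) (base_point ?c)"
      using p q c by (simp add: LMlt_mult N_LMlt base_point cocycle(1) conj_N_closed
          commutator_N_def N_closed)
    finally show "(case p \<star>\<^bsub>?X\<^esub> q of (a, n) \<Rightarrow> n (base_point a))
        = (case p of (a, n) \<Rightarrow> n (base_point a)) \<star> (case q of (a, n) \<Rightarrow> n (base_point a))"
      by (simp add: p(1) q(1) extension_def)
  qed (simp only: carrier bij_coordinates)
  then show ?thesis
    using lq_iso_inv[OF X.left_quasigroup_extension left_quasigroup_axioms]
    unfolding lq_isomorphic_def by blast
qed

end

theorem proposition7p8:
  fixes E :: "('a, 'c) left_quasigroup_scheme" and N :: "('a \<Rightarrow> 'a) set"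
  assumes "quandle E"
    and "subgroup N (Dis E)"
    and "N \<lhd> LMlt E"
    and "\<And>n g. \<lbrakk>n \<in> N; g \<in> carrier (Dis E)\<rbrakk> \<Longrightarrow> n \<otimes>\<^bsub>Dis E\<^esub> g = g \<otimes>\<^bsub>Dis E\<^esub> n"
    and "lq_connected (lq_quotient E (orbit_rel E N))"
  shows "\<exists>(A :: ('a \<Rightarrow> 'a) monoid) \<phi> \<psi> \<theta>.
           central_extension (lq_quotient E (orbit_rel E N)) A \<phi> \<psi> \<theta> \<and>
           lq_isomorphic E (extension (lq_quotient E (orbit_rel E N)) A \<phi> \<psi> \<theta>)"
proof -
  interpret quandle E by (rule assms(1))
  interpret central_dis_subgroup E N
  proof (intro central_dis_subgroup.intro central_dis_subgroup_axioms.intro)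
    show "N \<subseteq> carrier (Dis E)" by (rule subgroup.subset[OF assms(2)])
    show "n \<otimes>\<^bsub>LMlt E\<^esub> g = g \<otimes>\<^bsub>LMlt E\<^esub> n" if "n \<in> N" "g \<in> carrier (Dis E)" for n g
      using assms(4)[OF that] by (simp add: Dis_mult)
  qed (rule assms quandle_axioms)+
  show ?thesis
    using central_extension_N lq_isomorphic_extension_N by blast
qed

end
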